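(* For every integer $d\geq 1$ there are constants $C_d>0$ and $p_0=p_0(d)$, depending only on $d$, such that the following holds for every prime $p\geq p_0$ and every integer $k\geq 1$. Let $\Gamma$ be a set of $d$ integers. Then there is an integer $x$ with $1\leq x<p$ such that $$\max_{r\in\Gamma}\left\|x^k\frac{r}{p}\right\|\leq C_d\, p^{-1/(2d)}\,(\log p)\, k^{1/d}.$$
   Context: For real $\theta$, $\|\theta\|$ denotes the distance from $\theta$ to the nearest integer. The paper writes the conclusion as $\ll_d$, where $X\ll_d Y$ means that $X\leq cY$ for a constant $c$ depending only on $d$, once $p$ is sufficiently large. *)

theory Defs
  imports Complex_Main "HOL-Computational_Algebra.Primes"
begin

text \<open>The distance from a real number to the nearest integer. Ties in \<^const>\<open>round\<close> do not
  matter for the distance; see \<open>round_diff_minimal\<close> for minimality.\<close>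

definition dist_nearest_int :: "real \<Rightarrow> real" where
  "dist_nearest_int t = \<bar>t - of_int (round t)\<bar>"

end

theory Submission
  imports Defs "HOL-Library.FuncSet" "HOL-Number_Theory.Residues" "HOL-Analysis.Convex"
begin

text \<open>Write \<open>H\<close> for the set of nonzero \<open>k\<close>-th power residues. Cut the torus
  into \<open>M ^ d\<close> boxes of side \<open>1 / M\<close>; one of them contains \<open>(t r / p)\<close>, \<open>r \<in> \<Gamma>\<close>, for all \<open>t\<close>
  in a set \<open>A\<close> of at least \<open>p / M ^ d\<close> residues. If some \<open>k\<close>-th power \<open>x ^ k\<close> is a difference
  \<open>a - b\<close> with \<open>a, b \<in> A\<close>, then \<open>x\<close> is as required with error \<open>1 / M\<close>. In place of exponential sums,
  the second moment of the number of points on a random line of the affine plane over the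
  \<open>p\<close>-element field shows that such a difference exists as soon as \<open>|A| |H| > p powr (3/2)\<close>, and
  \<open>|H| \<ge> (p - 1) / k\<close> allows \<open>M ^ d\<close> of order \<open>sqrt p / k\<close>.\<close>

section \<open>Points and lines of the affine plane over the \<open>p\<close>-element field\<close>

text \<open>A pair \<open>(m, c)\<close> encodes the non-vertical line \<open>y = m x + c\<close>.
  The slope is free and determines the intercept.\<close>

lemma card_lines_through_point:
  fixes p x y :: int
  assumes "p > 0"
  shows "card {l \<in> {0..<p} \<times> {0..<p}. [y = fst l * x + snd l] (mod p)} = nat p"
proof -
  have "{l \<in> {0..<p} \<times> {0..<p}. [y = fst l * x + snd l] (mod p)}
      = (\<lambda>m. (m, (y - m * x) mod p)) ` {0..<p}" (is "?S = ?T")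
  proof (intro equalityI subsetI)
    fix l assume l: "l \<in> ?S"
    then obtain m c where mc: "l = (m, c)" "m \<in> {0..<p}" "c \<in> {0..<p}" "[y = m * x + c] (mod p)"
      by auto
    have "[y - m * x = m * x + c - m * x] (mod p)"
      using mc(4) by (intro cong_diff) auto
    then have "(y - m * x) mod p = c"
      using mc(3) by (simp add: cong_def)
    then show "l \<in> ?T"
      using mc by auto
  next
    fix l assume "l \<in> ?T"
    then show "l \<in> ?S"
      using assms by (auto simp: cong_def mod_simps)
  qed
  then show ?thesis
    by (simp add: card_image inj_on_def)
qed

text \<open>Two lines through both points have the same slope, since equal abscissas would force
  equal points. Only an upper bound is possible: distinct points with the same abscissa span a
  vertical line, which no pair encodes.\<close>

lemma card_lines_through_two_points:
  fixes p x y x' y' :: int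
  assumes p: "prime p"
    and q: "x \<in> {0..<p}" "y \<in> {0..<p}" "x' \<in> {0..<p}" "y' \<in> {0..<p}" "(x, y) \<noteq> (x', y')"
  shows "card {l \<in> {0..<p} \<times> {0..<p}.
    [y = fst l * x + snd l] (mod p) \<and> [y' = fst l * x' + snd l] (mod p)} \<le> 1" (is "card ?S \<le> 1")
proof -
  have fin: "finite ?S"
    by (rule finite_subset[of _ "{0..<p} \<times> {0..<p}"]) auto
  have "l = l'" if l: "l \<in> ?S" and l': "l' \<in> ?S" for l l'
  proof -
    obtain m c m' c' where e: "l = (m, c)" "l' = (m', c')"
      by fastforce
    have r: "m \<in> {0..<p}" "c \<in> {0..<p}" "m' \<in> {0..<p}" "c' \<in> {0..<p}"
      using l l' e by auto
    have d: "p dvd y - (m * x + c)" "p dvd y' - (m * x' + c)"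
      "p dvd y - (m' * x + c')" "p dvd y' - (m' * x' + c')"
      using l l' e by (auto simp: cong_iff_dvd_diff)
    have small: "u = v" if "p dvd u - v" "u \<in> {0..<p}" "v \<in> {0..<p}" for u v
      using that by (metis atLeastLessThan_iff cong_iff_dvd_diff cong_less_imp_eq_int)
    \<comment> \<open>This combination eliminates the ordinates and the intercepts.\<close>
    have "p dvd (y' - (m * x' + c)) - (y - (m * x + c)) - ((y' - (m' * x' + c')) - (y - (m' * x + c')))"
      by (rule dvd_diff[OF dvd_diff[OF d(2,1)] dvd_diff[OF d(4,3)]])
    also have "\<dots> = (m' - m) * (x' - x)"
      by (simp add: algebra_simps)
    finally have "p dvd m' - m \<or> p dvd x' - x"
      using p by (simp add: prime_dvd_mult_iff)
    moreover have False if "p dvd x' - x"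
    proof -
      have "x' = x"
        using small that q by blast
      then have "p dvd y' - y"
        using dvd_diff[OF d(2,1)] by simp
      then have "y' = y"
        using small q by blast
      then show False
        using \<open>x' = x\<close> q(5) by simp
    qed
    ultimately have m: "m' = m"
      using small r by blast
    have "p dvd c' - c"
      using dvd_diff[OF d(1,3)] m by simp
    then have "c' = c"
      using small r by blast
    then show ?thesis
      using m e by simp
  qed
  then show ?thesis
    unfolding One_nat_def card_le_Suc0_iff_eq[OF fin] by blast
qed

text \<open>The number \<open>i l\<close> of points of \<open>P\<close> on the line \<open>l\<close>
  has sum \<open>|P| p\<close> and sum of squares at most \<open>|P| (p + |P|)\<close> over all
  \<open>p^2\<close> lines. If it vanishes on \<open>L\<close>, Cauchy-Schwarz over the other lines
  gives \<open>|P| p^2 \<le> (p + |P|) (p^2 - |L|)\<close>, and expanding gives the bound.\<close>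

lemma incidence_free_bound:
  fixes p :: int and P L :: "(int \<times> int) set"
  assumes p: "prime p"
    and P: "P \<subseteq> {0..<p} \<times> {0..<p}" and L: "L \<subseteq> {0..<p} \<times> {0..<p}"
    and free: "\<And>q l. q \<in> P \<Longrightarrow> l \<in> L \<Longrightarrow> \<not> [snd q = fst l * fst q + snd l] (mod p)"
  shows "real (card P) * real (card L) \<le> real_of_int p ^ 3"
proof -
  define F where "F = {0..<p} \<times> {0..<p}"
  define on where "on q l \<longleftrightarrow> [snd q = fst l * fst q + snd l] (mod p)" for q l
  define i :: "int \<times> int \<Rightarrow> real" where "i l = (\<Sum>q\<in>P. of_bool (on q l))" for l
  define r where "r = real_of_int p"
  have p0: "p > 0"
    using p by (simp add: prime_gt_0_int)
  have finF: "finite F" "finite P" "finite L"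
    using P L by (auto simp: F_def intro: finite_subset)
  have r0: "r > 0"
    using p0 by (simp add: r_def)
  have cF: "real (card F) = r\<^sup>2"
    using p0 by (simp add: F_def r_def power2_eq_square)
  have card_on: "(\<Sum>l\<in>F. of_bool (on q l)) = r" for q
  proof -
    have "(\<Sum>l\<in>F. of_bool (on q l)) = real (card {l \<in> F. on q l})"
      using finF by (simp add: Int_def)
    then show ?thesis
      using card_lines_through_point[OF p0, of "snd q" "fst q"] p0 by (simp add: F_def on_def r_def)
  qed
  \<comment> \<open>The summand 1 is slack on the diagonal; it lets the double sum over
    \<open>P\<close> split into \<open>|P| r + |P|^2\<close>.\<close>
  have card_on2: "(\<Sum>l\<in>F. of_bool (on q l) * of_bool (on q' l)) \<le> (if q = q' then r else 0) + 1"
    if "q \<in> P" "q' \<in> P" for q q'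
  proof (cases "q = q'")
    case True
    then show ?thesis
      using card_on[of q'] by (simp flip: of_bool_conj)
  next
    case False
    have "fst q \<in> {0..<p}" "snd q \<in> {0..<p}" "fst q' \<in> {0..<p}" "snd q' \<in> {0..<p}"
      using that P by auto
    moreover have "(fst q, snd q) \<noteq> (fst q', snd q')"
      using False by simp
    ultimately have "card {l \<in> F. on q l \<and> on q' l} \<le> 1"
      unfolding F_def on_def by (rule card_lines_through_two_points[OF p])
    moreover have "(\<Sum>l\<in>F. of_bool (on q l) * of_bool (on q' l)) = real (card {l \<in> F. on q l \<and> on q' l})"
      using finF by (simp add: Int_def flip: of_bool_conj)
    ultimately show ?thesis
      using False by simp
  qed
  have sum1: "(\<Sum>l\<in>F. i l) = card P * r"
    unfolding i_def by (subst sum.swap) (simp add: card_on)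
  have "(\<Sum>l\<in>F. (i l)\<^sup>2) = (\<Sum>l\<in>F. \<Sum>q\<in>P. \<Sum>q'\<in>P. of_bool (on q l) * of_bool (on q' l))"
    by (simp only: i_def power2_eq_square sum_product)
  also have "\<dots> = (\<Sum>q\<in>P. \<Sum>q'\<in>P. \<Sum>l\<in>F. of_bool (on q l) * of_bool (on q' l))"
    by (subst sum.swap, rule sum.cong[OF refl], rule sum.swap)
  also have "\<dots> \<le> (\<Sum>q\<in>P. \<Sum>q'\<in>P. (if q = q' then r else 0) + 1)"
    by (intro sum_mono card_on2)
  also have "\<dots> = card P * (r + card P)"
    using finF by (simp add: sum.distrib algebra_simps)
  finally have sum2: "(\<Sum>l\<in>F. (i l)\<^sup>2) \<le> card P * (r + card P)" .
  have i0: "i l = 0" if "l \<in> L" for l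
    using free that by (simp add: i_def on_def)
  have LF: "L \<subseteq> F"
    using L by (simp add: F_def)
  \<comment> \<open>Dropping the zero terms first makes Cauchy-Schwarz count only
    \<open>r^2 - |L|\<close> lines; this is the whole gain.\<close>
  have "(card P * r)\<^sup>2 = (\<Sum>l\<in>F - L. i l)\<^sup>2"
    unfolding sum1[symmetric] using finF LF i0
    by (intro arg_cong[where f = "\<lambda>t. t\<^sup>2"] sum.mono_neutral_right) auto
  also have "\<dots> \<le> (\<Sum>l\<in>F - L. (i l)\<^sup>2) * card (F - L)"
    by (rule sum_squared_le_sum_of_squares)
  also have "(\<Sum>l\<in>F - L. (i l)\<^sup>2) = (\<Sum>l\<in>F. (i l)\<^sup>2)"
    using finF LF i0 by (intro sum.mono_neutral_left) auto
  also have "real (card (F - L)) = r\<^sup>2 - card L"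
    using finF LF cF card_mono[OF finF(1) LF] by (simp add: card_Diff_subset of_nat_diff)
  finally have "(card P * r)\<^sup>2 \<le> (\<Sum>l\<in>F. (i l)\<^sup>2) * (r\<^sup>2 - card L)" .
  also have "\<dots> \<le> card P * (r + card P) * (r\<^sup>2 - card L)"
    using sum2 card_mono[OF finF(1) LF] cF by (intro mult_right_mono) (auto simp flip: cF)
  finally have *: "card P * (card P * r\<^sup>2) \<le> card P * ((r + card P) * (r\<^sup>2 - card L))"
    by (simp add: power2_eq_square algebra_simps)
  show ?thesis
  proof (cases "card P = 0")
    case False
    then have "card P * r\<^sup>2 \<le> (r + card P) * (r\<^sup>2 - card L)"
      using * by simp
    then have "real (card P) * real (card L) + r * real (card L) \<le> r ^ 3"
      by (simp add: algebra_simps power2_eq_square power3_eq_cube)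
    moreover have "r * real (card L) \<ge> 0"
      using r0 by simp
    ultimately show ?thesis
      by (simp add: r_def)
  qed (use p0 in simp)
qed

text \<open>A solution is an incidence between the points \<open>(h, h b)\<close> and the lines
  \<open>y = a x - h'\<close>.\<close>

lemma exists_ratio_eq_difference:
  fixes p :: int and A H :: "int set"
  assumes p: "prime p"
    and A: "A \<subseteq> {0..<p}" and H: "H \<subseteq> {1..<p}"
    and large: "(real (card A) * real (card H))\<^sup>2 > real_of_int p ^ 3"
  shows "\<exists>a\<in>A. \<exists>b\<in>A. \<exists>h\<in>H. \<exists>h'\<in>H. [h' = h * (a - b)] (mod p)"
proof (rule ccontr)
  assume none: "\<not> ?thesis"
  have p0: "p > 0"
    using p by (simp add: prime_gt_0_int)
  \<comment> \<open>Both sets will have \<open>|A| |H|\<close> elements, so that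
    \<open>large\<close> reads \<open>|P| |L| > p^3\<close>. For \<open>P\<close> this uses that
    each \<open>h\<close> is invertible modulo \<open>p\<close>.\<close>
  define P where "P = (\<lambda>(h, b). (h, h * b mod p)) ` (H \<times> A)"
  define L where "L = (\<lambda>(a, h). (a, - h mod p)) ` (A \<times> H)"
  have small: "u = v" if "[u = v] (mod p)" "u \<in> {0..<p}" "v \<in> {0..<p}" for u v
    using that by (metis atLeastLessThan_iff cong_less_imp_eq_int)
  have H': "H \<subseteq> {0..<p}"
    using H by auto
  have "inj_on (\<lambda>(h, b). (h, h * b mod p)) (H \<times> A)"
  proof (rule inj_onI, clarsimp)
    fix h b b' assume *: "h \<in> H" "b \<in> A" "b' \<in> A" "h * b mod p = h * b' mod p"
    have "\<not> p dvd h"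
      using * H zdvd_not_zless[of h p] by auto
    then have "coprime h p"
      using p by (metis coprime_commute prime_imp_coprime)
    then have "[b = b'] (mod p)"
      using *(4) cong_mult_lcancel by (auto simp: cong_def)
    then show "b = b'"
      using small * A by blast
  qed
  then have cP: "card P = card H * card A"
    by (simp add: P_def card_image card_cartesian_product)
  have "inj_on (\<lambda>(a, h). (a, - h mod p)) (A \<times> H)"
  proof (rule inj_onI, clarsimp)
    fix h h' assume *: "h \<in> H" "h' \<in> H" "- h mod p = - h' mod p"
    then have "[h = h'] (mod p)"
      using cong_minus_minus_iff[of h h' p] by (simp add: cong_def)
    then show "h = h'"
      using small * H' by blast
  qed
  then have cL: "card L = card H * card A"
    by (simp add: L_def card_image card_cartesian_product mult.commute)
  have "real (card P) * real (card L) \<le> real_of_int p ^ 3"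
  proof (rule incidence_free_bound[OF p])
    show "P \<subseteq> {0..<p} \<times> {0..<p}" "L \<subseteq> {0..<p} \<times> {0..<p}"
      using A H' p0 by (auto simp: P_def L_def)
    fix q l assume "q \<in> P" "l \<in> L"
    then obtain h b a h' where
      *: "h \<in> H" "b \<in> A" "q = (h, h * b mod p)" "a \<in> A" "h' \<in> H" "l = (a, - h' mod p)"
      by (auto simp: P_def L_def)
    show "\<not> [snd q = fst l * fst q + snd l] (mod p)"
    proof
      assume "[snd q = fst l * fst q + snd l] (mod p)"
      then have "[h * b = a * h - h'] (mod p)"
        using * by (simp add: cong_def mod_simps)
      then have "[h' = h * (a - b)] (mod p)"
        by (simp add: cong_iff_dvd_diff algebra_simps dvd_diff_commute)
      then show False
        using none * by blast
    qed
  qed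
  then show False
    using large by (simp add: cP cL power2_eq_square algebra_simps)
qed

section \<open>Power residues, boxes in the torus, and their combination\<close>

text \<open>Over a field a residue has at most \<open>k\<close> roots of order \<open>k\<close>, so
  the fibres of \<open>x ^ k\<close> on the \<open>p - 1\<close> units have at most \<open>k\<close>
  elements.\<close>

lemma card_kth_power_residues:
  fixes p k :: nat
  assumes "prime p" "k > 0"
  shows "p - 1 \<le> k * card ((\<lambda>x. x ^ k mod p) ` {1..<p})"
proof -
  let ?H = "(\<lambda>x. x ^ k mod p) ` {1..<p}"
  have "{1..<p} \<subseteq> (\<Union>c\<in>?H. {x \<in> {..<p}. [x ^ k = c] (mod p)})"
    by (auto simp: cong_def)
  then have "card {1..<p} \<le> card (\<Union>c\<in>?H. {x \<in> {..<p}. [x ^ k = c] (mod p)})"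
    by (intro card_mono) auto
  also have "\<dots> \<le> (\<Sum>c\<in>?H. card {x \<in> {..<p}. [x ^ k = c] (mod p)})"
    by (rule card_UN_le) auto
  also have "\<dots> \<le> (\<Sum>c\<in>?H. k)"
    by (intro sum_mono roots_mod_prime_bound assms)
  finally show ?thesis
    by (simp add: mult.commute)
qed

lemma dist_nearest_int_le: "dist_nearest_int t \<le> \<bar>t - of_int m\<bar>"
  unfolding dist_nearest_int_def by (rule round_diff_minimal)

text \<open>The shift \<open>n\<close> will absorb the multiple of \<open>p\<close> by which
  \<open>x ^ k\<close> differs from \<open>a - b\<close>.\<close>

lemma dist_nearest_int_le_if_same_box:
  fixes t u :: real
  assumes "M > 0" "\<lfloor>real M * frac t\<rfloor> = \<lfloor>real M * frac u\<rfloor>"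
  shows "dist_nearest_int (t - u + of_int n) \<le> 1 / real M"
proof -
  have "\<bar>real M * frac t - real M * frac u\<bar> \<le> 1"
    using assms(2) by linarith
  then have "real M * \<bar>frac t - frac u\<bar> \<le> 1"
    by (simp add: abs_mult flip: right_diff_distrib)
  then have "\<bar>frac t - frac u\<bar> \<le> 1 / real M"
    using assms(1) by (simp add: field_simps)
  moreover have "frac t - frac u = t - u + of_int n - of_int (n + \<lfloor>t\<rfloor> - \<lfloor>u\<rfloor>)"
    by (simp add: frac_def)
  ultimately show ?thesis
    using dist_nearest_int_le[of "t - u + of_int n" "n + \<lfloor>t\<rfloor> - \<lfloor>u\<rfloor>"] by simp
qed

lemma dirichlet_box:
  fixes p M :: nat and \<Gamma> :: "int set"
  assumes "M > 0" "finite \<Gamma>"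
  obtains A where "A \<subseteq> {0..<int p}" "p \<le> card A * M ^ card \<Gamma>"
    "\<And>a b r. \<lbrakk>a \<in> A; b \<in> A; r \<in> \<Gamma>\<rbrakk> \<Longrightarrow>
      \<lfloor>real M * frac (of_int a * (of_int r / real p))\<rfloor> =
      \<lfloor>real M * frac (of_int b * (of_int r / real p))\<rfloor>"
proof -
  \<comment> \<open>\<open>f t\<close> is the index of the box containing the point of
    \<open>t\<close>. Restricting it to \<open>\<Gamma>\<close> makes the set \<open>B\<close> of
    possible indices finite, of size \<open>M ^ card \<Gamma>\<close>; \<open>A\<close> will be a
    large fibre.\<close>
  define f :: "int \<Rightarrow> int \<Rightarrow> int" where
    "f = (\<lambda>t. restrict (\<lambda>r. \<lfloor>real M * frac (of_int t * (of_int r / real p))\<rfloor>) \<Gamma>)"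
  define B where "B = \<Gamma> \<rightarrow>\<^sub>E {0..<int M}"
  have "\<lfloor>real M * frac s\<rfloor> \<in> {0..<int M}" for s :: real
  proof -
    have "real M * frac s < real M"
      using assms(1) frac_lt_1[of s] by simp
    then show ?thesis
      using frac_ge_0[of s] by (simp add: floor_less_iff)
  qed
  then have fB: "f \<in> {0..<int p} \<rightarrow> B"
    by (auto simp: f_def B_def)
  have B: "finite B" "B \<noteq> {}" "card B = M ^ card \<Gamma>"
    using assms by (auto simp: B_def card_funcsetE PiE_eq_empty_iff intro!: finite_PiE)
  obtain y where y: "card (f -` {y} \<inter> {0..<int p}) * card B \<ge> card {0..<int p}"
    using pigeonhole_card[OF fB _ B(1,2)] by auto
  show ?thesis
  proof (rule that[of "f -` {y} \<inter> {0..<int p}"])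
    fix a b r assume ab: "a \<in> f -` {y} \<inter> {0..<int p}" "b \<in> f -` {y} \<inter> {0..<int p}" "r \<in> \<Gamma>"
    then have "f a r = f b r"
      by auto
    then show "\<lfloor>real M * frac (of_int a * (of_int r / real p))\<rfloor> =
      \<lfloor>real M * frac (of_int b * (of_int r / real p))\<rfloor>"
      using ab(3) by (simp add: f_def)
  qed (use y B in auto)
qed

text \<open>A ratio of powers is a power: \<open>z\<close> is \<open>y / x\<close> modulo
  \<open>p\<close>. This turns \<open>h' = h (a - b)\<close> with \<open>h\<close>,
  \<open>h'\<close> in \<open>H\<close> into \<open>z ^ k = a - b\<close>.\<close>

lemma power_ratio_mod_prime:
  fixes p x y e :: int
  assumes p: "prime p" and x: "\<not> p dvd x" and y: "\<not> p dvd y"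
    and xy: "[y ^ k = x ^ k * e] (mod p)"
  obtains z where "1 \<le> z" "z < p" "[z ^ k = e] (mod p)"
proof -
  have cop: "coprime x p"
    using p x by (metis coprime_commute prime_imp_coprime)
  then obtain w where w: "[x * w = 1] (mod p)"
    using cong_solve_coprime_int by blast
  define z where "z = y * w mod p"
  have p0: "p > 0"
    using p by (simp add: prime_gt_0_int)
  have "\<not> p dvd w"
  proof
    assume "p dvd w"
    then have "p dvd 1"
      using w by (metis cong_dvd_iff dvd_mult)
    then show False
      using p by (meson not_prime_unit)
  qed
  then have "\<not> p dvd y * w"
    using y p by (simp add: prime_dvd_mult_iff)
  then have "z \<noteq> 0"
    by (simp add: z_def dvd_eq_mod_eq_0)
  then have "1 \<le> z" "z < p"
    using p0 pos_mod_sign[OF p0, of "y * w"] pos_mod_bound[OF p0, of "y * w"]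
    unfolding z_def by linarith+
  moreover have "[z ^ k = e] (mod p)"
  proof -
    have "[z ^ k = (y * w) ^ k] (mod p)"
      unfolding z_def by (intro cong_pow) simp
    also have "(y * w) ^ k = y ^ k * w ^ k"
      by (simp add: power_mult_distrib)
    also have "[y ^ k * w ^ k = x ^ k * e * w ^ k] (mod p)"
      by (intro cong_mult xy) simp
    also have "x ^ k * e * w ^ k = (x * w) ^ k * e"
      by (simp add: power_mult_distrib)
    also have "[(x * w) ^ k * e = 1 ^ k * e] (mod p)"
      by (intro cong_mult cong_pow w) simp
    finally show ?thesis
      by simp
  qed
  ultimately show ?thesis
    using that by blast
qed

text \<open>From \<open>|A| M ^ d \<ge> p\<close>, with \<open>d = card \<Gamma>\<close>, and
  \<open>k |H| \<ge> p - 1 \<ge> p / 2\<close> follows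
  \<open>|A| |H| \<ge> p^2 / (2 k M ^ d)\<close>, and \<open>small\<close> makes this exceed
  \<open>p powr (3/2)\<close>.\<close>

lemma simultaneous_power_approximation:
  fixes p k M :: nat and \<Gamma> :: "int set"
  assumes p: "prime p" and k: "k > 0" and M: "M > 0" and \<Gamma>: "finite \<Gamma>"
    and small: "(2 * k * M ^ card \<Gamma>)\<^sup>2 < p"
  shows "\<exists>x::int. 1 \<le> x \<and> x < int p \<and>
    (\<forall>r\<in>\<Gamma>. dist_nearest_int (real_of_int (x ^ k) * (real_of_int r / real p)) \<le> 1 / real M)"
proof -
  obtain A where A: "A \<subseteq> {0..<int p}" "p \<le> card A * M ^ card \<Gamma>"
    and box: "\<And>a b r. \<lbrakk>a \<in> A; b \<in> A; r \<in> \<Gamma>\<rbrakk> \<Longrightarrow>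
      \<lfloor>real M * frac (of_int a * (of_int r / real p))\<rfloor> =
      \<lfloor>real M * frac (of_int b * (of_int r / real p))\<rfloor>"
    using dirichlet_box[OF M \<Gamma>, of p] by metis
  define H0 where "H0 = (\<lambda>x. x ^ k mod p) ` {1..<p}"
  define H where "H = int ` H0"
  have p2: "p \<ge> 2"
    using p by (rule prime_ge_2_nat)
  have cH: "p - 1 \<le> k * card H"
    using card_kth_power_residues[OF p k] by (simp add: H_def H0_def card_image)
  have "H \<subseteq> {1..<int p}"
  proof -
    have "x ^ k mod p \<noteq> 0" if "x \<in> {1..<p}" for x
      using that p prime_dvd_power_nat[OF p, of x k] nat_dvd_not_less[of x p]
      by (auto simp: dvd_eq_mod_eq_0[symmetric])
    then show ?thesis
      using p2 by (fastforce simp: H_def H0_def)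
  qed
  moreover have "(real (card A) * real (card H))\<^sup>2 > real_of_int (int p) ^ 3"
  proof -
    define N where "N = 2 * k * M ^ card \<Gamma>"
    define c where "c = card A * card H"
    have "p * p \<le> p * (2 * (p - 1))"
      using p2 by (intro mult_left_mono) auto
    also have "\<dots> \<le> (card A * M ^ card \<Gamma>) * (2 * (k * card H))"
      using A(2) cH by (intro mult_mono) auto
    also have "\<dots> = c * N"
      by (simp add: N_def c_def)
    finally have 1: "p * p \<le> c * N" .
    then have "c > 0"
      using p2 by (cases "c = 0") auto
    \<comment> \<open>The extra factor \<open>p\<close> avoids division by \<open>N\<close> and is
      cancelled at the end.\<close>
    have "p ^ 3 * p = (p * p)\<^sup>2"
      by (simp add: power2_eq_square power3_eq_cube)
    also have "\<dots> \<le> (c * N)\<^sup>2"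
      using 1 by (intro power_mono) auto
    also have "\<dots> = c\<^sup>2 * N\<^sup>2"
      by (simp add: power_mult_distrib)
    also have "\<dots> < c\<^sup>2 * p"
      using small \<open>c > 0\<close> by (simp add: N_def)
    finally have "p ^ 3 < c\<^sup>2"
      by simp
    then have "real (p ^ 3) < real (c\<^sup>2)"
      by (rule of_nat_less_iff[THEN iffD2])
    then show ?thesis
      by (simp add: c_def)
  qed
  moreover have pi: "prime (int p)"
    using p by simp
  ultimately obtain a b h h' where abh: "a \<in> A" "b \<in> A" "h \<in> H" "h' \<in> H" "[h' = h * (a - b)] (mod int p)"
    using exists_ratio_eq_difference[of "int p" A H] A(1) by blast
  obtain x y where x: "x \<in> {1..<p}" "h = int (x ^ k mod p)" and y: "y \<in> {1..<p}" "h' = int (y ^ k mod p)"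
    using abh by (auto simp: H_def H0_def)
  have "[int y ^ k = int x ^ k * (a - b)] (mod int p)"
    using abh(5) x y by (simp add: cong_def zmod_int mod_simps)
  moreover have "\<not> int p dvd int x" "\<not> int p dvd int y"
    using x y by (auto dest: nat_dvd_not_less)
  ultimately obtain z where z: "1 \<le> z" "z < int p" "[z ^ k = a - b] (mod int p)"
    using power_ratio_mod_prime[OF pi] by metis
  obtain n where n: "z ^ k = a - b + int p * n"
    using z(3) by (metis cong_iff_lin cong_sym)
  have "dist_nearest_int (real_of_int (z ^ k) * (real_of_int r / real p)) \<le> 1 / real M" if "r \<in> \<Gamma>" for r
  proof -
    \<comment> \<open>The multiple \<open>p n\<close> of the modulus contributes the integer
      \<open>n r\<close>.\<close>
    have "real_of_int (z ^ k) * (real_of_int r / real p) =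
      real_of_int a * (real_of_int r / real p) - real_of_int b * (real_of_int r / real p) + of_int (n * r)"
      unfolding n using p2 by (simp add: field_simps)
    then show ?thesis
      using dist_nearest_int_le_if_same_box[OF M box[OF abh(1,2) that], of "n * r"] by simp
  qed
  then show ?thesis
    using z by blast
qed

section \<open>Choice of the number of boxes and the constants\<close>

theorem theorem2p3:
  fixes d :: nat
  assumes "d \<ge> 1"
  shows "\<exists>(C::real) (p0::nat). C > 0 \<and>
    (\<forall>(p::nat) (k::nat) (\<Gamma>::int set).
       prime p \<and> p \<ge> p0 \<and> k \<ge> 1 \<and> finite \<Gamma> \<and> card \<Gamma> = d \<longrightarrow>
       (\<exists>x::int. 1 \<le> x \<and> x < int p \<and>
          Max ((\<lambda>r. dist_nearest_int (real_of_int (x ^ k) * (real_of_int r / real p))) ` \<Gamma>)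
            \<le> C * real p powr (- 1 / (2 * real d)) * ln (real p) * real k powr (1 / real d)))"
\<comment> \<open>The constant 8 is 4 from \<open>1 / Q \<le> 4 * E\<close> times 2 from rounding
  \<open>Q\<close> down to an integer. For \<open>p \<ge> 3\<close> the logarithm is at least 1, so
  the bound \<open>8 * E\<close> suffices.\<close>
proof (rule exI[of _ 8], rule exI[of _ 3], intro conjI allI impI)
  fix p k :: nat and \<Gamma> :: "int set"
  assume hyp: "prime p \<and> p \<ge> 3 \<and> k \<ge> 1 \<and> finite \<Gamma> \<and> card \<Gamma> = d"
  then have p: "prime p" "p \<ge> 3" and k: "k \<ge> 1" and \<Gamma>: "finite \<Gamma>" "card \<Gamma> = d"
    by auto
  have ne: "\<Gamma> \<noteq> {}"
    using \<Gamma> assms by auto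
  define E where "E = real p powr (- 1 / (2 * real d)) * real k powr (1 / real d)"
  \<comment> \<open>The real-valued size of \<open>M\<close>. The 4, twice the factor 2 in the
    smallness condition, leaves room for the strict inequality there.\<close>
  define Q where "Q = (sqrt (real p) / (4 * real k)) powr (1 / real d)"
  have E0: "E > 0" and Q0: "Q > 0"
    using p k by (auto simp: E_def Q_def)
  have "exp 1 \<le> (3::real)"
    using exp_le by simp
  then have "1 \<le> ln (real p)"
    using p(2) by (subst ln_ge_iff) auto
  then have bound: "8 * E \<le> 8 * real p powr (- 1 / (2 * real d)) * ln (real p) * real k powr (1 / real d)"
    using E0 mult_left_mono[of 1 "ln (real p)" "8 * E"] by (simp add: E_def mult_ac)
  have Qd: "Q ^ d = sqrt (real p) / (4 * real k)"
    using assms p k by (simp add: Q_def powr_realpow[symmetric] powr_powr)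
  have "1 / Q = 4 powr (1 / real d) * E"
    using p k by (simp add: Q_def E_def powr_divide powr_mult powr_half_sqrt[symmetric] powr_powr powr_minus field_simps)
  \<comment> \<open>This makes the constant uniform in \<open>d\<close>.\<close>
  also have "\<dots> \<le> 4 powr 1 * E"
    using E0 assms by (intro mult_right_mono powr_mono) auto
  finally have QE: "1 / Q \<le> 4 * E"
    by simp
  have "\<exists>x::int. 1 \<le> x \<and> x < int p \<and>
    (\<forall>r\<in>\<Gamma>. dist_nearest_int (real_of_int (x ^ k) * (real_of_int r / real p)) \<le> 8 * E)"
  proof (cases "Q < 1")
    \<comment> \<open>No positive \<open>M\<close> lies below \<open>Q\<close>, but then
      \<open>8 * E\<close> exceeds 1/2, the largest possible distance, and \<open>x = 1\<close> will
      do.\<close>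
    case True
    then have "1 / Q > 1"
      using Q0 by simp
    then have "1/2 \<le> 8 * E"
      using QE by linarith
    moreover have "dist_nearest_int t \<le> 1/2" for t
      unfolding dist_nearest_int_def using of_int_round_abs_le[of t] by (simp add: abs_minus_commute)
    ultimately have "dist_nearest_int t \<le> 8 * E" for t
      by (rule order_trans[rotated])
    then show ?thesis
      using p(2) by (intro exI[of _ 1]) auto
  next
    case False
    define M where "M = nat \<lfloor>Q\<rfloor>"
    have "\<lfloor>Q\<rfloor> \<ge> 1"
      using False by simp
    then have "real M = of_int \<lfloor>Q\<rfloor>" "M > 0"
      by (simp_all add: M_def)
    moreover from \<open>M > 0\<close> have "real M \<ge> 1"
      by linarith
    \<comment> \<open>As \<open>Q \<ge> 1\<close>, rounding down loses at most a factor 2.\<close>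
    ultimately have M: "M > 0" "real M \<le> Q" "Q \<le> 2 * real M"
      by linarith+
    have "real M ^ d \<le> sqrt (real p) / (4 * real k)"
      using power_mono[OF M(2), of d] Qd by simp
    then have "2 * (2 * real k * real M ^ d) \<le> sqrt (real p)"
      using k by (simp add: field_simps)
    moreover have "2 * real k * real M ^ d > 0"
      using k M(1) by simp
    ultimately have "2 * real k * real M ^ d < sqrt (real p)"
      by linarith
    then have "(2 * real k * real M ^ d)\<^sup>2 < (sqrt (real p))\<^sup>2"
      using k by (intro power_strict_mono) auto
    then have "real ((2 * k * M ^ card \<Gamma>)\<^sup>2) < real p"
      using \<Gamma>(2) by simp
    then have N: "(2 * k * M ^ card \<Gamma>)\<^sup>2 < p"
      by (rule of_nat_less_imp_less)
    have "k > 0"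
      using k by simp
    then obtain x :: int where x: "1 \<le> x" "x < int p"
      "\<And>r. r \<in> \<Gamma> \<Longrightarrow> dist_nearest_int (real_of_int (x ^ k) * (real_of_int r / real p)) \<le> 1 / real M"
      using simultaneous_power_approximation[OF p(1) _ M(1) \<Gamma>(1) N] by blast
    have "1 / real M \<le> 2 * (1 / Q)"
      using M Q0 by (simp add: field_simps)
    then have "1 / real M \<le> 8 * E"
      using QE by linarith
    then show ?thesis
      using x by (meson order_trans)
  qed
  then obtain x :: int where x: "1 \<le> x" "x < int p"
    "\<And>r. r \<in> \<Gamma> \<Longrightarrow> dist_nearest_int (real_of_int (x ^ k) * (real_of_int r / real p)) \<le> 8 * E"
    by blast
  have "Max ((\<lambda>r. dist_nearest_int (real_of_int (x ^ k) * (real_of_int r / real p))) ` \<Gamma>) \<le> 8 * E"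
    using \<Gamma>(1) ne x(3) by (subst Max_le_iff) auto
  then show "\<exists>x::int. 1 \<le> x \<and> x < int p \<and>
          Max ((\<lambda>r. dist_nearest_int (real_of_int (x ^ k) * (real_of_int r / real p))) ` \<Gamma>)
            \<le> 8 * real p powr (- 1 / (2 * real d)) * ln (real p) * real k powr (1 / real d)"
    using x(1,2) bound by (meson order_trans)
qed simp

end
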